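(* Let $\theta_0>\theta_1>\theta_2$ and let $\Gamma$ be a biregular graph in $\mathcal{G}(\theta_0,\theta_1,\theta_2)$ whose adjacency matrix $A$ under the valency partition $\{V_1,V_2\}$ has block form $$A=\begin{pmatrix} A_1 & B_1\\ B_2 & A_2\end{pmatrix}\quad\text{with quotient matrix}\quad\begin{pmatrix} k_{11} & k_{12}\\ k_{21} & k_{22}\end{pmatrix},$$ and set $n_i=|V_i|$. Let $i\in\{1,2\}$, let $j$ be such that $\{i,j\}=\{1,2\}$, and let $m$ be a positive integer with $n_i/m\geq 2$. Suppose that one of the following holds. (i) The subgraph induced on $V_i$ is a complete $m$-partite graph. In this case set $\lambda_1=\alpha_i^2-k_{ii}$ and $\lambda_2=\alpha_i^2+\theta_1+\theta_2-k_{ii}+n_i/m$. (ii) The subgraph induced on $V_i$ is the disjoint union of $m$ cliques $K_{n_i/m}$. In this case set $\lambda_1=\alpha_i^2+\theta_1+\theta_2+1-k_{ii}$ and $\lambda_2=\alpha_i^2$. In either case, the matrix $B_i$ is an incidence matrix (rows indexed by points $V_i$, columns indexed by blocks $V_j$) of a group divisible design with parameters $(n_i,n_j;k_{ij},k_{ji};\lambda_1,\lambda_2;m,n_i/m)$.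
   Context: All graphs are finite and simple; eigenvalues of a graph are those of its adjacency matrix; valency means degree. $\mathcal{G}(\theta_0,\theta_1,\theta_2)$ denotes the set of connected nonregular graphs having precisely three distinct eigenvalues $\theta_0>\theta_1>\theta_2$. A graph is biregular if it has precisely two distinct valencies $k_1>k_2$; $V_i$ is the set of vertices of valency $k_i$, $\{V_1,V_2\}$ is the valency partition, and $k_{ij}$ is the average number of neighbours in $V_j$ of vertices of $V_i$ (for these graphs the valency partition is known to be equitable, so every vertex of $V_i$ has exactly $k_{ij}$ neighbours in $V_j$). There is a unique positive vector $\alpha$ with $(A-\theta_1I)(A-\theta_2I)=\alpha\alpha^{\top}$; a vertex of valency $k_i$ has $\alpha$-entry $\alpha_i=\sqrt{k_i+\theta_1\theta_2}$. A $(v,b,r,k)$-configuration is a set $V$ of $v$ points with a collection of $k$-subsets $B_1,\dots,B_b$ (blocks; repetitions allowed) such that each point occurs in precisely $r$ blocks. It is a group divisible design with parameters $(v,b;r,k;\lambda_1,\lambda_2;m,n)$ if the points can be partitioned into $m$ sets $T_1,\dots,T_m$ each of size $n\geq 2$ such that any two distinct points $x\in T_i$, $y\in T_j$ occur together in $\lambda_1$ blocks if $i=j$ and in $\lambda_2$ blocks otherwise. (In case $m=1$ the condition on $\lambda_2$ is vacuous. A complete $1$-partite graph is an edgeless graph.) *)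

theory Defs
  imports
    "HOL-Analysis.Analysis"
    "HOL-Library.Disjoint_Sets"
    "Graph_Theory.Graph_Theory"
begin

text \<open>
  Finite simple graphs are the models of the locale predicate \<open>graph\<close> of the entry
  \<open>Graph_Theory\<close>: an undirected edge is a pair of opposite arcs, so the valency of a vertex is
  its out-degree. Matrices over the vertices need a finite index type, hence
  \<open>three_eigenvalue_graph\<close> below requires the vertex set to be all of the vertex type.
\<close>

definition adj_matrix :: "('v::finite, 'e) pre_digraph \<Rightarrow> real^'v^'v" where
  "adj_matrix G = (\<chi> x y. if x \<rightarrow>\<^bsub>G\<^esub> y then 1 else 0)"

definition eigenvalue :: "real^'n^'n \<Rightarrow> real \<Rightarrow> bool" where
  "eigenvalue M \<theta> \<longleftrightarrow> (\<exists>u. u \<noteq> 0 \<and> M *v u = \<theta> *\<^sub>R u)"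

definition regular :: "('v, 'e) pre_digraph \<Rightarrow> bool" where
  "regular G \<longleftrightarrow> (\<exists>k. \<forall>x\<in>verts G. out_degree G x = k)"

text \<open>
  Only real eigenvalues are considered: nothing is lost, as adjacency matrices are symmetric.
  The qualified name avoids topological connectedness.
\<close>

definition three_eigenvalue_graph ::
    "real \<Rightarrow> real \<Rightarrow> real \<Rightarrow> ('v::finite, 'e) pre_digraph \<Rightarrow> bool" where
  "three_eigenvalue_graph \<theta>0 \<theta>1 \<theta>2 G \<longleftrightarrow>
     graph G \<and> verts G = UNIV \<and> Digraph_Component.connected G \<and> \<not> regular G \<and>
     \<theta>0 > \<theta>1 \<and> \<theta>1 > \<theta>2 \<and> {\<theta>. eigenvalue (adj_matrix G) \<theta>} = {\<theta>0, \<theta>1, \<theta>2}"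

definition biregular :: "nat \<Rightarrow> nat \<Rightarrow> ('v, 'e) pre_digraph \<Rightarrow> bool" where
  "biregular k1 k2 G \<longleftrightarrow> k1 > k2 \<and> out_degree G ` verts G = {k1, k2}"

definition valency_class :: "('v, 'e) pre_digraph \<Rightarrow> nat \<Rightarrow> 'v set" where
  "valency_class G k = {x \<in> verts G. out_degree G x = k}"

definition avg_neighbours :: "('v, 'e) pre_digraph \<Rightarrow> 'v set \<Rightarrow> 'v set \<Rightarrow> real" where
  "avg_neighbours G X Y = (\<Sum>x\<in>X. real (card {y \<in> Y. x \<rightarrow>\<^bsub>G\<^esub> y})) / real (card X)"

text \<open>
  For \<open>G\<close> in the class above, this is the unique positive vector \<open>\<alpha>\<close> with
  \<open>(A - \<theta>1 I)(A - \<theta>2 I) = \<alpha> \<alpha>\<^sup>T\<close> (\<open>mat \<theta>\<close> is \<open>\<theta> I\<close>).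
\<close>

definition alpha_vector :: "('v::finite, 'e) pre_digraph \<Rightarrow> real \<Rightarrow> real \<Rightarrow> real^'v" where
  "alpha_vector G \<theta>1 \<theta>2 =
     (THE \<alpha>. (\<forall>x. \<alpha> $ x > 0) \<and>
        (adj_matrix G - mat \<theta>1) ** (adj_matrix G - mat \<theta>2) = (\<chi> x y. \<alpha> $ x * \<alpha> $ y))"

text \<open>The parts need not have equal size; for \<open>m = 1\<close> the graph is edgeless.\<close>

definition complete_multipartite :: "nat \<Rightarrow> ('v, 'e) pre_digraph \<Rightarrow> bool" where
  "complete_multipartite m H \<longleftrightarrow>
     (\<exists>P. partition_on (verts H) P \<and> card P = m \<and>
        (\<forall>x\<in>verts H. \<forall>y\<in>verts H. x \<rightarrow>\<^bsub>H\<^esub> y \<longleftrightarrow> \<not> (\<exists>T\<in>P. x \<in> T \<and> y \<in> T)))"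

definition disjoint_cliques :: "nat \<Rightarrow> nat \<Rightarrow> ('v, 'e) pre_digraph \<Rightarrow> bool" where
  "disjoint_cliques m c H \<longleftrightarrow>
     (\<exists>P. partition_on (verts H) P \<and> card P = m \<and>
        (\<forall>T\<in>P. complete_digraph c (H \<restriction> T)) \<and>
        (\<forall>S\<in>P. \<forall>T\<in>P. S \<noteq> T \<longrightarrow> (\<forall>x\<in>S. \<forall>y\<in>T. \<not> x \<rightarrow>\<^bsub>H\<^esub> y)))"

text \<open>
  Blocks are given as a family \<open>B\<close> over an index set \<open>J\<close>, so that they may be repeated. The
  parameters \<open>r\<close>, \<open>k\<close>, \<open>lam1\<close>, \<open>lam2\<close> are real numbers, so that averages and expressions in the
  eigenvalues can be substituted for them; the design conditions force \<open>r\<close>, \<open>k\<close> and \<open>lam1\<close> (for nonempty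
  \<open>X\<close> and \<open>J\<close>) to be natural numbers, and likewise \<open>lam2\<close> unless \<open>m = 1\<close>, where it is
  unconstrained.
\<close>

definition configuration ::
    "'p set \<Rightarrow> 'b set \<Rightarrow> ('b \<Rightarrow> 'p set) \<Rightarrow> nat \<Rightarrow> nat \<Rightarrow> real \<Rightarrow> real \<Rightarrow> bool" where
  "configuration X J B v b r k \<longleftrightarrow>
     finite X \<and> card X = v \<and> finite J \<and> card J = b \<and>
     (\<forall>z\<in>J. B z \<subseteq> X \<and> real (card (B z)) = k) \<and>
     (\<forall>x\<in>X. real (card {z \<in> J. x \<in> B z}) = r)"

definition group_divisible_design ::
    "'p set \<Rightarrow> 'b set \<Rightarrow> ('b \<Rightarrow> 'p set) \<Rightarrow>
     nat \<Rightarrow> nat \<Rightarrow> real \<Rightarrow> real \<Rightarrow> real \<Rightarrow> real \<Rightarrow> nat \<Rightarrow> nat \<Rightarrow> bool" where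
  "group_divisible_design X J B v b r k lam1 lam2 m n \<longleftrightarrow>
     configuration X J B v b r k \<and> n \<ge> 2 \<and>
     (\<exists>P. partition_on X P \<and> card P = m \<and> (\<forall>T\<in>P. card T = n) \<and>
        (\<forall>S\<in>P. \<forall>T\<in>P. \<forall>x\<in>S. \<forall>y\<in>T. x \<noteq> y \<longrightarrow>
           real (card {z \<in> J. x \<in> B z \<and> y \<in> B z}) = (if S = T then lam1 else lam2)))"

text \<open>The rows of the matrix are indexed by the points \<open>X\<close>, its columns by the blocks \<open>J\<close>.\<close>

definition incidence_matrix ::
    "('p \<Rightarrow> 'b \<Rightarrow> real) \<Rightarrow> 'p set \<Rightarrow> 'b set \<Rightarrow> ('b \<Rightarrow> 'p set) \<Rightarrow> bool" where
  "incidence_matrix N X J B \<longleftrightarrow> (\<forall>x\<in>X. \<forall>z\<in>J. N x z = (if x \<in> B z then 1 else 0))"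

end

theory Submission
  imports Defs
begin

text \<open>
  The adjacency matrix \<open>A\<close> is symmetric, hence annihilated by the product of its three factors
  \<open>A - \<theta>\<^sub>i I\<close>. So the columns of \<open>(A - \<theta>\<^sub>1 I)(A - \<theta>\<^sub>2 I)\<close> lie in the \<open>\<theta>\<^sub>0\<close>-eigenspace,
  which by Perron-Frobenius is spanned by a positive vector, and the product is \<open>\<alpha> \<alpha>\<^sup>T\<close>. Its diagonal
  shows that \<open>\<alpha>\<close> takes a single value on each valency class, and then \<open>A \<alpha> = \<theta>\<^sub>0 \<alpha>\<close> makes the valency
  partition equitable. Its off-diagonal entries give the number of common neighbours of two vertices
  of \<open>V\<^sub>i\<close>; subtracting the common neighbours inside \<open>V\<^sub>i\<close>, which depend only on whether the two
  vertices lie in the same part, leaves the number of common blocks.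
\<close>

section \<open>Symmetric matrices and the Perron eigenvector\<close>

lemma symmetric_matrix_inner:
  fixes A :: "real^'n^'n"
  assumes "transpose A = A"
  shows "x \<bullet> (A *v y) = (A *v x) \<bullet> y"
  by (metis assms dot_lmul_matrix vector_transpose_matrix)

text \<open>The form \<open>q x = \<theta> * (x \<bullet> x) - x \<bullet> (A *v x)\<close> is
  nonnegative on \<open>S\<close> and zero at \<open>v\<close>. A nonzero residual \<open>y\<close>
  of the eigenvector equation lies in \<open>S\<close> by invariance, and a small step
  \<open>t\<close> along it changes \<open>q\<close> to first order by
  \<open>- 2 * t * (y \<bullet> y)\<close>, making \<open>q\<close> negative.\<close>

lemma rayleigh_maximizer_is_eigenvector:
  fixes A :: "real^'n^'n"
  assumes sym: "transpose A = A" and S: "subspace S" and inv: "(*v) A ` S \<subseteq> S"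
    and bound: "\<And>x. x \<in> S \<Longrightarrow> x \<bullet> (A *v x) \<le> \<theta> * (x \<bullet> x)"
    and v: "v \<in> S" and attained: "v \<bullet> (A *v v) = \<theta> * (v \<bullet> v)"
  shows "A *v v = \<theta> *\<^sub>R v"
proof (rule ccontr)
  define q where "q x = \<theta> * (x \<bullet> x) - x \<bullet> (A *v x)" for x
  define y where "y = A *v v - \<theta> *\<^sub>R v"
  assume "A *v v \<noteq> \<theta> *\<^sub>R v"
  then have ypos: "y \<bullet> y > 0"
    by (simp add: y_def)
  have yS: "y \<in> S"
    unfolding y_def using S v inv by (intro subspace_diff subspace_scale) auto
  \<comment> \<open>With this step \<open>y \<bullet> y = t * (q y + 1)\<close>, so the quadratic
    term \<open>t\<^sup>2 * q y\<close> is \<open>t * (y \<bullet> y) - t\<^sup>2\<close> and cannot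
    offset the linear one. The \<open>+ 1\<close> keeps the denominator positive when
    \<open>q y = 0\<close>.\<close>
  define t where "t = (y \<bullet> y) / (q y + 1)"
  have "q y \<ge> 0"
    using bound[OF yS] by (simp add: q_def)
  have "q (v + t *\<^sub>R y) = q v + 2 * t * (\<theta> * (v \<bullet> y) - (A *v v) \<bullet> y) + t\<^sup>2 * q y"
  proof -
    have "y \<bullet> v = v \<bullet> y" "y \<bullet> (A *v v) = v \<bullet> (A *v y)" "(A *v v) \<bullet> y = v \<bullet> (A *v y)"
      using symmetric_matrix_inner[OF sym, of v y] by (simp_all add: inner_commute)
    then show ?thesis
      by (simp add: q_def matrix_vector_right_distrib matrix_vector_mult_scaleR
          power2_eq_square algebra_simps)
  qed
  also have "\<theta> * (v \<bullet> y) - (A *v v) \<bullet> y = - (y \<bullet> y)"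
    by (simp add: y_def inner_simps algebra_simps)
  also have "q v = 0"
    using attained by (simp add: q_def)
  also have "0 + 2 * t * - (y \<bullet> y) + t\<^sup>2 * q y = - t * (y \<bullet> y) - t\<^sup>2"
  proof -
    have "y \<bullet> y = t * (q y + 1)"
      using \<open>q y \<ge> 0\<close> by (simp add: t_def)
    then show ?thesis
      by (simp add: power2_eq_square algebra_simps)
  qed
  also have "\<dots> < 0"
  proof -
    have "t > 0"
      using ypos \<open>q y \<ge> 0\<close> by (simp add: t_def)
    then have "t * (y \<bullet> y) > 0"
      using ypos by simp
    then show ?thesis
      using zero_le_power2[of t] by linarith
  qed
  finally have "q (v + t *\<^sub>R y) < 0" .
  moreover have "v + t *\<^sub>R y \<in> S"
    using S v yS by (intro subspace_add subspace_scale)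
  ultimately show False
    using bound[of "v + t *\<^sub>R y"] by (simp add: q_def)
qed

text \<open>The unit sphere of \<open>S\<close> is compact, so the Rayleigh quotient attains its
  maximum there, and a maximizer is an eigenvector. The bound is returned too, for use in the Perron
  argument.\<close>

lemma symmetric_matrix_eigenvector_in_subspace:
  fixes A :: "real^'n^'n"
  assumes sym: "transpose A = A" and S: "subspace S" and inv: "(*v) A ` S \<subseteq> S"
    and nz: "S \<noteq> {0}"
  obtains v \<theta> where "v \<in> S" "v \<noteq> 0" "A *v v = \<theta> *\<^sub>R v"
    "\<And>x. x \<in> S \<Longrightarrow> x \<bullet> (A *v x) \<le> \<theta> * (x \<bullet> x)"
proof -
  obtain s where s: "s \<in> S" "s \<noteq> 0"
    using nz S subspace_0 by blast
  let ?K = "sphere 0 1 \<inter> S"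
  have "compact ?K"
    by (intro compact_Int_closed compact_sphere closed_subspace S)
  moreover have "(1 / norm s) *\<^sub>R s \<in> ?K"
    using s S by (simp add: subspace_scale)
  then have "?K \<noteq> {}"
    by blast
  moreover have "continuous_on ?K (\<lambda>x. x \<bullet> (A *v x))"
    by (intro continuous_intros)
  ultimately obtain v where v: "v \<in> ?K" and max: "\<And>x. x \<in> ?K \<Longrightarrow> x \<bullet> (A *v x) \<le> v \<bullet> (A *v v)"
    using continuous_attains_sup[of ?K "\<lambda>x. x \<bullet> (A *v x)"] by blast
  define \<theta> where "\<theta> = v \<bullet> (A *v v)"
  have bound: "x \<bullet> (A *v x) \<le> \<theta> * (x \<bullet> x)" if "x \<in> S" for x
  proof (cases "x = 0")
    case False
    let ?u = "(1 / norm x) *\<^sub>R x"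
    have "?u \<bullet> (A *v ?u) \<le> \<theta>"
      unfolding \<theta>_def using that False S by (intro max) (simp add: subspace_scale)
    then show ?thesis
      using False by (simp add: matrix_vector_mult_scaleR dot_square_norm field_simps power2_eq_square)
  qed simp
  have "v \<bullet> v = 1"
    using v by (simp add: dot_square_norm)
  then have "A *v v = \<theta> *\<^sub>R v"
    using v by (intro rayleigh_maximizer_is_eigenvector[OF sym S inv bound]) (auto simp: \<theta>_def)
  then show ?thesis
    using that v bound \<open>v \<bullet> v = 1\<close> by (metis IntD2 inner_zero_left zero_neq_one)
qed

text \<open>The operator form of \<open>A - \<theta> I\<close>: products of such factors become
  compositions, whose commutation is plain linear algebra.\<close>

definition shift :: "real^'n^'n \<Rightarrow> real \<Rightarrow> real^'n \<Rightarrow> real^'n" where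
  "shift A \<theta> x = A *v x - \<theta> *\<^sub>R x"

lemma shift_matrix: "(A - mat \<theta>) *v x = shift A \<theta> x"
proof -
  have "mat \<theta> *v x = \<theta> *\<^sub>R x"
    by (simp add: vec_eq_iff matrix_vector_mult_def mat_def if_distrib[of "\<lambda>a. a * b" for b] cong: if_cong)
  then show ?thesis
    by (simp add: shift_def matrix_vector_mult_diff_rdistrib)
qed

lemma linear_shift: "linear (shift A \<theta>)"
  using matrix_vector_mul_linear[of "A - mat \<theta>"] by (simp add: shift_matrix)

lemma shift_commute_matrix: "A *v shift A \<theta> x = shift A \<theta> (A *v x)"
  by (simp add: shift_def matrix_vector_mult_diff_distrib matrix_vector_mult_scaleR)

lemma shift_inner:
  assumes "transpose A = A"
  shows "x \<bullet> shift A \<theta> y = shift A \<theta> x \<bullet> y"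
  using symmetric_matrix_inner[OF assms, of x y] by (simp add: shift_def inner_simps)

text \<open>Otherwise the range of the product contains an eigenvector \<open>v\<close>, which the product kills;
  being self-adjoint, it then maps no vector to \<open>v\<close>.\<close>

lemma symmetric_matrix_annihilated:
  fixes A :: "real^'n^'n"
  assumes sym: "transpose A = A" and eig: "\<And>\<theta>. eigenvalue A \<theta> \<Longrightarrow> \<theta> \<in> {a, b, c}"
  shows "shift A a (shift A b (shift A c x)) = 0"
proof (rule ccontr)
  let ?M = "\<lambda>x. shift A a (shift A b (shift A c x))"
  let ?R = "range ?M"
  assume nz: "?M x \<noteq> 0"
  have lin: "linear ?M"
    using linear_compose[OF linear_compose[OF linear_shift[of A c] linear_shift[of A b]] linear_shift[of A a]]
    by (simp add: o_def)
  have comm: "shift A s (shift A t y) = shift A t (shift A s y)" for s t y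
    by (simp add: shift_def matrix_vector_mult_diff_distrib matrix_vector_mult_scaleR algebra_simps)
  have nz': "?R \<noteq> {0}"
    using nz by blast
  have inv: "(*v) A ` ?R \<subseteq> ?R"
    by (auto simp: shift_commute_matrix)
  obtain v \<theta> where v: "v \<in> ?R" "v \<noteq> 0" "A *v v = \<theta> *\<^sub>R v"
    by (rule symmetric_matrix_eigenvector_in_subspace[OF sym linear_subspace_image[OF lin subspace_UNIV] inv nz'])
  then have "\<theta> \<in> {a, b, c}"
    using eig by (auto simp: eigenvalue_def)
  moreover have "shift A \<theta> v = 0"
    using v by (simp add: shift_def)
  moreover have "shift A t 0 = 0" for t
    by (simp add: shift_def)
  \<comment> \<open>The factor belonging to the eigenvalue of \<open>v\<close> can be commuted to
    act first, and it kills \<open>v\<close>.\<close>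
  ultimately have "?M v = 0"
    by (metis comm empty_iff insert_iff)
  obtain u where "v = ?M u"
    using v by blast
  then have "v \<bullet> v = u \<bullet> ?M v"
    by (metis comm shift_inner[OF sym])
  then show False
    using \<open>?M v = 0\<close> v by simp
qed

text \<open>Strong connectivity of the digraph of nonzero entries, phrased by closed index sets
  because the Perron argument applies it to the zero set of an eigenvector.\<close>

definition irreducible_matrix :: "real^'n^'n \<Rightarrow> bool" where
  "irreducible_matrix A \<longleftrightarrow>
     (\<forall>S. S \<noteq> {} \<longrightarrow> (\<forall>x\<in>S. \<forall>y. A $ x $ y \<noteq> 0 \<longrightarrow> y \<in> S) \<longrightarrow> S = UNIV)"

lemma irreducible_matrixD:
  assumes "irreducible_matrix A" "S \<noteq> {}" "\<And>x y. x \<in> S \<Longrightarrow> A $ x $ y \<noteq> 0 \<Longrightarrow> y \<in> S"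
  shows "S = UNIV"
  using assms unfolding irreducible_matrix_def by metis

text \<open>Taking absolute values does not decrease the Rayleigh quotient, so it preserves the eigenspace
  of \<open>\<theta>\<close>. By irreducibility no nonzero vector of this eigenspace has a zero entry, which forces
  the eigenspace to be a line.\<close>

lemma perron_eigenvector:
  fixes A :: "real^'n^'n"
  assumes sym: "transpose A = A" and nonneg: "\<And>x y. A $ x $ y \<ge> 0"
    and irred: "irreducible_matrix A"
    and eig: "eigenvalue A \<theta>" and max: "\<And>t. eigenvalue A t \<Longrightarrow> t \<le> \<theta>"
  obtains v where "\<And>x. v $ x > 0" "A *v v = \<theta> *\<^sub>R v"
    "\<And>u. A *v u = \<theta> *\<^sub>R u \<Longrightarrow> \<exists>c. u = c *\<^sub>R v"
proof -
  have "UNIV \<noteq> {0 :: real^'n}"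
    using eig by (auto simp: eigenvalue_def)
  \<comment> \<open>A maximizer over the whole space is an eigenvector, so its quotient
    \<open>t\<close> is at most the largest eigenvalue \<open>\<theta>\<close>. Hence
    \<open>\<theta>\<close> bounds every Rayleigh quotient.\<close>
  then obtain z t where zt: "z \<noteq> 0" "A *v z = t *\<^sub>R z"
    "\<And>x. x \<bullet> (A *v x) \<le> t * (x \<bullet> x)"
    using symmetric_matrix_eigenvector_in_subspace[OF sym subspace_UNIV subset_UNIV] by (metis UNIV_I)
  have "t \<le> \<theta>"
    using zt max by (auto simp: eigenvalue_def)
  then have bound: "x \<bullet> (A *v x) \<le> \<theta> * (x \<bullet> x)" for x
    using zt(3)[of x] by (meson inner_ge_zero mult_right_mono order_trans)
  define vabs :: "real^'n \<Rightarrow> real^'n" where "vabs u = (\<chi> x. \<bar>u $ x\<bar>)" for u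
  have vabs: "A *v vabs u = \<theta> *\<^sub>R vabs u" if "A *v u = \<theta> *\<^sub>R u" for u
  proof (rule rayleigh_maximizer_is_eigenvector[OF sym subspace_UNIV subset_UNIV])
    have "u \<bullet> (A *v u) \<le> vabs u \<bullet> (A *v vabs u)"
    proof -
      have "u $ x * (A $ x $ y * u $ y) \<le> \<bar>u $ x\<bar> * (A $ x $ y * \<bar>u $ y\<bar>)" for x y
        by (metis abs_ge_self abs_mult abs_of_nonneg nonneg)
      then show ?thesis
        by (auto simp: inner_vec_def matrix_vector_mult_def vabs_def sum_distrib_left intro!: sum_mono)
    qed
    moreover have "vabs u \<bullet> vabs u = u \<bullet> u"
      by (simp add: inner_vec_def vabs_def)
    ultimately show "vabs u \<bullet> (A *v vabs u) = \<theta> * (vabs u \<bullet> vabs u)"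
      using bound[of "vabs u"] that by simp
  qed (use bound in auto)
  have nowhere_zero: "u $ x \<noteq> 0" if u: "A *v u = \<theta> *\<^sub>R u" "u \<noteq> 0" for u x
  proof
    assume "u $ x = 0"
    \<comment> \<open>At an index in \<open>?Z\<close> the eigenvector equation for
      \<open>vabs u\<close> is a vanishing sum of nonnegative terms. Each term vanishes, so
      \<open>?Z\<close> is closed under nonzero entries.\<close>
    let ?Z = "{y. vabs u $ y = 0}"
    have "z \<in> ?Z" if "y \<in> ?Z" "A $ y $ z \<noteq> 0" for y z
    proof -
      have "(\<Sum>w\<in>UNIV. A $ y $ w * vabs u $ w) = (A *v vabs u) $ y"
        by (simp add: matrix_vector_mult_def)
      also have "\<dots> = 0"
        using that vabs[OF u(1)] by simp
      finally have "A $ y $ z * vabs u $ z = 0"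
        by (subst (asm) sum_nonneg_eq_0_iff) (auto simp: nonneg vabs_def)
      then show ?thesis
        using that by simp
    qed
    moreover have "x \<in> ?Z"
      using \<open>u $ x = 0\<close> by (simp add: vabs_def)
    ultimately have "?Z = UNIV"
      by (intro irreducible_matrixD[OF irred]) blast+
    then have "u = 0"
      by (auto simp: vabs_def vec_eq_iff)
    then show False
      using u by simp
  qed
  obtain u where u: "u \<noteq> 0" "A *v u = \<theta> *\<^sub>R u"
    using eig by (auto simp: eigenvalue_def)
  show ?thesis
  proof
    show pos: "vabs u $ x > 0" for x
      using nowhere_zero[OF u(2,1)] by (simp add: vabs_def)
    show "A *v vabs u = \<theta> *\<^sub>R vabs u"
      using vabs u by simp
    show "\<exists>c. u' = c *\<^sub>R vabs u" if "A *v u' = \<theta> *\<^sub>R u'" for u'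
    proof -
      obtain x :: 'n where True
        by simp
      define d where "d = u' - (u' $ x / vabs u $ x) *\<^sub>R vabs u"
      \<comment> \<open>The multiple in \<open>d\<close> is chosen so that \<open>d\<close> vanishes
        at \<open>x\<close>; satisfying the eigenvector equation as well, \<open>d\<close> must be
        zero by \<open>nowhere_zero\<close>.\<close>
      have "A *v d = \<theta> *\<^sub>R d"
        unfolding d_def using that vabs[OF u(2)]
        by (simp add: matrix_vector_mult_diff_distrib matrix_vector_mult_scaleR scaleR_diff_right)
      moreover have "d $ x = 0"
        using pos[of x] by (simp add: d_def)
      ultimately have "d = 0"
        using nowhere_zero by blast
      then show ?thesis
        by (auto simp: d_def)
    qed
  qed
qed

text \<open>All columns are multiples of the Perron vector \<open>v\<close>, and symmetry reduces
  the multipliers to one scalar \<open>c\<close>. Once \<open>c\<close> is positive, its square root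
  scales \<open>v\<close> to \<open>\<alpha>\<close>.\<close>

lemma three_eigenvalue_rank_one:
  fixes A :: "real^'n^'n"
  assumes sym: "transpose A = A" and nonneg: "\<And>x y. A $ x $ y \<ge> 0"
    and irred: "irreducible_matrix A"
    and eig: "{t. eigenvalue A t} = {\<theta>0, \<theta>1, \<theta>2}" and less: "\<theta>1 < \<theta>0" "\<theta>2 < \<theta>1"
  obtains \<alpha> where "\<And>x. \<alpha> $ x > 0" "A *v \<alpha> = \<theta>0 *\<^sub>R \<alpha>"
    "(A - mat \<theta>1) ** (A - mat \<theta>2) = (\<chi> x y. \<alpha> $ x * \<alpha> $ y)"
proof -
  have eigD: "eigenvalue A t \<longleftrightarrow> t \<in> {\<theta>0, \<theta>1, \<theta>2}" for t
    using eig by blast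
  then have "eigenvalue A \<theta>0" and "\<And>t. eigenvalue A t \<Longrightarrow> t \<le> \<theta>0"
    using less by auto
  then obtain v where v: "\<And>x. v $ x > 0" "A *v v = \<theta>0 *\<^sub>R v"
    "\<And>u. A *v u = \<theta>0 *\<^sub>R u \<Longrightarrow> \<exists>c. u = c *\<^sub>R v"
    using perron_eigenvector[OF sym nonneg irred] by blast
  define N where "N = (A - mat \<theta>1) ** (A - mat \<theta>2)"
  have N: "N *v x = shift A \<theta>1 (shift A \<theta>2 x)" for x
    by (simp add: N_def matrix_vector_mul_assoc[symmetric] shift_matrix)
  have "shift A \<theta>0 (N *v x) = 0" for x
    unfolding N by (rule symmetric_matrix_annihilated[OF sym]) (use eigD in blast)
  then have "\<exists>c. N *v x = c *\<^sub>R v" for x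
    using v(3) by (simp add: shift_def)
  have "\<exists>c. \<forall>x. N $ x $ y = c * v $ x" for y
  proof -
    obtain c where "N *v axis y 1 = c *\<^sub>R v"
      using \<open>\<And>x. \<exists>c. N *v x = c *\<^sub>R v\<close> by blast
    then have "column y N $ x = c * v $ x" for x
      by (simp add: matrix_vector_mult_basis)
    then show ?thesis
      by (auto simp: column_def)
  qed
  then obtain t where t: "N $ x $ y = t y * v $ x" for x y
    by metis
  have Nsym: "N $ x $ y = N $ y $ x" for x y
  proof -
    have "axis x 1 \<bullet> (N *v axis y 1) = (N *v axis x 1) \<bullet> axis y 1"
      unfolding N by (simp add: shift_inner[OF sym])
        (simp add: shift_def matrix_vector_mult_diff_distrib matrix_vector_mult_scaleR algebra_simps)
    then show ?thesis
      by (simp add: inner_axis inner_axis' matrix_vector_mult_basis column_def)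
  qed
  obtain z :: 'n where True
    by simp
  \<comment> \<open>Symmetry gives \<open>t y * v $ z = t z * v $ y\<close>, so \<open>t\<close> is
    itself proportional to \<open>v\<close>; the ratio is read off at an arbitrary index
    \<open>z\<close>.\<close>
  define c where "c = t z / v $ z"
  have Nc: "N $ x $ y = c * v $ x * v $ y" for x y
  proof -
    have "t y * v $ z = t z * v $ y"
      using Nsym[of z y] t by metis
    then have "t y = c * v $ y"
      using v(1)[of z] by (simp add: c_def field_simps)
    then show ?thesis
      by (simp add: t)
  qed
  \<comment> \<open>Computing \<open>N *v v\<close> from the eigenvalue and from the entries of
    \<open>N\<close> gives \<open>c * (v \<bullet> v) = (\<theta>0 - \<theta>1) * (\<theta>0 -
    \<theta>2)\<close>, where both factors on the right are positive.\<close>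
  have "c > 0"
  proof -
    have "N *v v = ((\<theta>0 - \<theta>1) * (\<theta>0 - \<theta>2)) *\<^sub>R v"
      unfolding N by (simp add: shift_def v(2) matrix_vector_mult_diff_distrib
          matrix_vector_mult_scaleR algebra_simps)
    moreover have "(N *v v) $ z = c * (v \<bullet> v) * v $ z"
      by (simp add: matrix_vector_mult_def Nc inner_vec_def sum_distrib_left sum_distrib_right ac_simps)
    ultimately have "c * (v \<bullet> v) * v $ z = (\<theta>0 - \<theta>1) * (\<theta>0 - \<theta>2) * v $ z"
      by (metis real_scaleR_def vector_scaleR_component)
    then have "c * (v \<bullet> v) = (\<theta>0 - \<theta>1) * (\<theta>0 - \<theta>2)"
      using v(1)[of z] by (metis less_irrefl mult_right_cancel)
    moreover have "\<dots> > 0"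
      using less by simp
    ultimately show ?thesis
      by (metis inner_ge_zero linorder_not_less mult_nonpos_nonneg)
  qed
  show ?thesis
  proof
    show "(sqrt c *\<^sub>R v) $ x > 0" for x
      using v(1) \<open>c > 0\<close> by simp
    show "A *v (sqrt c *\<^sub>R v) = \<theta>0 *\<^sub>R (sqrt c *\<^sub>R v)"
      by (simp add: matrix_vector_mult_scaleR v(2))
    show "(A - mat \<theta>1) ** (A - mat \<theta>2) = (\<chi> x y. (sqrt c *\<^sub>R v) $ x * (sqrt c *\<^sub>R v) $ y)"
      using \<open>c > 0\<close> by (simp add: vec_eq_iff N_def[symmetric] Nc algebra_simps real_sqrt_mult_self)
  qed
qed

section \<open>Graphs with three eigenvalues\<close>

lemma (in wf_digraph) adjacent_iff_induce_subgraph: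
  assumes "x \<in> S" "y \<in> S"
  shows "x \<rightarrow>\<^bsub>G \<restriction> S\<^esub> y \<longleftrightarrow> x \<rightarrow>\<^bsub>G\<^esub> y"
  using assms by (auto simp: arcs_ends_conv)

text \<open>Without parallel arcs, \<open>head G\<close> is injective on the arcs leaving
  \<open>x\<close>.\<close>

lemma out_degree_eq_card:
  assumes "graph G"
  shows "out_degree G x = card {y. x \<rightarrow>\<^bsub>G\<^esub> y}"
proof -
  interpret graph G by fact
  have "head G ` out_arcs G x = {y. x \<rightarrow>\<^bsub>G\<^esub> y}"
    by (auto simp: arcs_ends_conv out_arcs_def)
  moreover have "inj_on (head G) (out_arcs G x)"
    by (auto intro!: inj_onI no_multi_arcs simp: out_arcs_def arc_to_ends_def)
  ultimately show ?thesis
    unfolding out_degree_def by (metis card_image)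
qed

lemma graph_adjacent_sym:
  assumes "graph G"
  shows "x \<rightarrow>\<^bsub>G\<^esub> y \<longleftrightarrow> y \<rightarrow>\<^bsub>G\<^esub> x"
proof -
  interpret graph G by fact
  show ?thesis
    using sym_arcs by (auto simp: symmetric_def dest: symD)
qed

lemma graph_adjacent_irrefl:
  assumes "graph G"
  shows "\<not> x \<rightarrow>\<^bsub>G\<^esub> x"
proof -
  interpret graph G by fact
  show ?thesis
    using no_loops by (auto simp: arcs_ends_conv)
qed

lemma transpose_adj_matrix:
  assumes "graph G"
  shows "transpose (adj_matrix G) = adj_matrix G"
proof -
  have "adj_matrix G $ y $ x = adj_matrix G $ x $ y" for x y
    using graph_adjacent_sym[OF assms, of x y] by (simp add: adj_matrix_def)
  then show ?thesis
    by (simp add: transpose_def vec_eq_iff)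
qed

lemma irreducible_adj_matrix:
  assumes "graph G" "verts G = UNIV" "Digraph_Component.connected G"
  shows "irreducible_matrix (adj_matrix G)"
  unfolding irreducible_matrix_def
proof (intro allI impI)
  interpret graph G by fact
  fix S assume S: "S \<noteq> {}" "\<forall>x\<in>S. \<forall>y. adj_matrix G $ x $ y \<noteq> 0 \<longrightarrow> y \<in> S"
  then obtain x where "x \<in> S"
    by blast
  have "y \<in> S" for y
  proof -
    \<comment> \<open>Connectedness refers to the symmetric closure, which adds no reachability
      because the arcs are already symmetric.\<close>
    have "x \<rightarrow>\<^sup>*\<^bsub>mk_symmetric G\<^esub> y"
      using assms by (simp add: connected_def strongly_connected_def)
    then have "x \<rightarrow>\<^sup>*\<^bsub>G\<^esub> y"
      using reachable_mk_symmetric_eq[OF sym_arcs] by blast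
    then show ?thesis
      by (induction rule: reachable_induct) (use \<open>x \<in> S\<close> S in \<open>auto simp: adj_matrix_def\<close>)
  qed
  then show "S = UNIV"
    by blast
qed

text \<open>The product expands to the square of \<open>A\<close> minus \<open>(a + b) A\<close>
  plus \<open>a b I\<close>, and the square counts walks of length two.\<close>

lemma adj_matrix_shift_product:
  "((adj_matrix G - mat a) ** (adj_matrix G - mat b)) $ x $ y =
     real (card {z. x \<rightarrow>\<^bsub>G\<^esub> z \<and> z \<rightarrow>\<^bsub>G\<^esub> y}) - (a + b) * adj_matrix G $ x $ y
       + (if x = y then a * b else 0)"
proof -
  let ?A = "adj_matrix G"
  have "((?A - mat a) ** (?A - mat b)) $ x $ y =
      (\<Sum>z\<in>UNIV. ?A $ x $ z * ?A $ z $ y - (if z = y then b * ?A $ x $ y else 0)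
        - (if x = z then a * ?A $ x $ y else 0) + (if x = z then (if x = y then a * b else 0) else 0))"
    unfolding matrix_matrix_mult_def
    by (auto simp: mat_def algebra_simps intro!: sum.cong)
  also have "\<dots> = (\<Sum>z\<in>UNIV. ?A $ x $ z * ?A $ z $ y) - (a + b) * ?A $ x $ y
      + (if x = y then a * b else 0)"
    by (simp add: sum.distrib sum_subtractf algebra_simps)
  also have "(\<Sum>z\<in>UNIV. ?A $ x $ z * ?A $ z $ y) = (\<Sum>z\<in>UNIV. if x \<rightarrow>\<^bsub>G\<^esub> z \<and> z \<rightarrow>\<^bsub>G\<^esub> y then 1 else 0)"
    by (intro sum.cong) (auto simp: adj_matrix_def)
  also have "\<dots> = real (card {z. x \<rightarrow>\<^bsub>G\<^esub> z \<and> z \<rightarrow>\<^bsub>G\<^esub> y})"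
    by (simp add: sum.If_cases)
  finally show ?thesis .
qed

lemma positive_rank_one_factor_unique:
  fixes \<alpha> \<beta> :: "real^'n"
  assumes "\<And>x. \<alpha> $ x > 0" "\<And>x. \<beta> $ x > 0"
    and "(\<chi> x y. \<alpha> $ x * \<alpha> $ y) = (\<chi> x y. \<beta> $ x * \<beta> $ y)"
  shows "\<alpha> = \<beta>"
proof -
  have "(\<alpha> $ x)\<^sup>2 = (\<beta> $ x)\<^sup>2" for x
    using assms(3) by (simp add: vec_eq_iff power2_eq_square)
  then show ?thesis
    using assms(1,2) by (metis less_imp_le power2_eq_imp_eq vec_eq_iff)
qed

text \<open>Existence and uniqueness discharge the description in \<open>alpha_vector\<close>. The
  eigenvector equation is not part of that description; it is recorded for the equitability
  argument.\<close>

lemma three_eigenvalue_graph_alpha_vector: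
  assumes "three_eigenvalue_graph \<theta>0 \<theta>1 \<theta>2 G"
  shows "alpha_vector G \<theta>1 \<theta>2 $ x > 0"
    and "adj_matrix G *v alpha_vector G \<theta>1 \<theta>2 = \<theta>0 *\<^sub>R alpha_vector G \<theta>1 \<theta>2"
    and "(adj_matrix G - mat \<theta>1) ** (adj_matrix G - mat \<theta>2) =
      (\<chi> x y. alpha_vector G \<theta>1 \<theta>2 $ x * alpha_vector G \<theta>1 \<theta>2 $ y)"
proof -
  let ?A = "adj_matrix G"
  note G = assms[unfolded three_eigenvalue_graph_def]
  obtain \<alpha> where \<alpha>: "\<And>x. \<alpha> $ x > 0" "?A *v \<alpha> = \<theta>0 *\<^sub>R \<alpha>"
    "(?A - mat \<theta>1) ** (?A - mat \<theta>2) = (\<chi> x y. \<alpha> $ x * \<alpha> $ y)"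
  proof (rule three_eigenvalue_rank_one)
    show "transpose ?A = ?A"
      using G by (simp add: transpose_adj_matrix)
    show "?A $ x $ y \<ge> 0" for x y
      by (simp add: adj_matrix_def)
    show "irreducible_matrix ?A"
      using G by (simp add: irreducible_adj_matrix)
  qed (use G in auto)
  have "alpha_vector G \<theta>1 \<theta>2 = \<alpha>"
    unfolding alpha_vector_def
  proof (rule the_equality)
    fix \<beta> assume "(\<forall>x. \<beta> $ x > 0) \<and>
      (?A - mat \<theta>1) ** (?A - mat \<theta>2) = (\<chi> x y. \<beta> $ x * \<beta> $ y)"
    then show "\<beta> = \<alpha>"
      using \<alpha>(1,3) by (intro positive_rank_one_factor_unique) auto
  qed (use \<alpha> in auto)
  then show "alpha_vector G \<theta>1 \<theta>2 $ x > 0"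
    and "?A *v alpha_vector G \<theta>1 \<theta>2 = \<theta>0 *\<^sub>R alpha_vector G \<theta>1 \<theta>2"
    and "(?A - mat \<theta>1) ** (?A - mat \<theta>2) =
      (\<chi> x y. alpha_vector G \<theta>1 \<theta>2 $ x * alpha_vector G \<theta>1 \<theta>2 $ y)"
    using \<alpha> by auto
qed

section \<open>Common neighbours and valencies from \<open>\<alpha>\<close>\<close>

lemma alpha_vector_common_neighbours:
  assumes "three_eigenvalue_graph \<theta>0 \<theta>1 \<theta>2 G"
  shows "real (card {z. x \<rightarrow>\<^bsub>G\<^esub> z \<and> z \<rightarrow>\<^bsub>G\<^esub> y}) =
    alpha_vector G \<theta>1 \<theta>2 $ x * alpha_vector G \<theta>1 \<theta>2 $ y + (\<theta>1 + \<theta>2) * adj_matrix G $ x $ y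
      - (if x = y then \<theta>1 * \<theta>2 else 0)"
  using adj_matrix_shift_product[of G \<theta>1 \<theta>2 x y] three_eigenvalue_graph_alpha_vector(3)[OF assms]
  by simp

text \<open>This is the diagonal case: the common neighbours of \<open>x\<close> with itself are all
  its neighbours.\<close>

lemma alpha_vector_square:
  assumes "three_eigenvalue_graph \<theta>0 \<theta>1 \<theta>2 G"
  shows "(alpha_vector G \<theta>1 \<theta>2 $ x)\<^sup>2 = real (out_degree G x) + \<theta>1 * \<theta>2"
proof -
  have G: "graph G"
    using assms by (simp add: three_eigenvalue_graph_def)
  then have "{z. x \<rightarrow>\<^bsub>G\<^esub> z \<and> z \<rightarrow>\<^bsub>G\<^esub> x} = {z. x \<rightarrow>\<^bsub>G\<^esub> z}" "adj_matrix G $ x $ x = 0"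
    using graph_adjacent_sym[OF G, of x] graph_adjacent_irrefl[OF G] by (auto simp: adj_matrix_def)
  then show ?thesis
    using alpha_vector_common_neighbours[OF assms, of x x] out_degree_eq_card[OF G, of x]
    by (simp add: power2_eq_square)
qed

section \<open>Equitability from a two-valued eigenvector\<close>

text \<open>The valency of \<open>x\<close> and the eigenvector equation at \<open>x\<close> are two independent linear
  equations for the numbers of neighbours of \<open>x\<close> inside and outside \<open>Y\<close>.\<close>

lemma two_valued_eigenvector_equitable:
  fixes u :: "real^'v"
  assumes G: "graph G" and eig: "adj_matrix G *v u = \<theta> *\<^sub>R u"
    and Y: "\<And>y. y \<in> Y \<Longrightarrow> u $ y = a" "\<And>y. y \<notin> Y \<Longrightarrow> u $ y = b" and "a \<noteq> b"
    and same: "out_degree G x = out_degree G x'" "u $ x = u $ x'"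
  shows "card {y \<in> Y. x \<rightarrow>\<^bsub>G\<^esub> y} = card {y \<in> Y. x' \<rightarrow>\<^bsub>G\<^esub> y}"
proof -
  \<comment> \<open>The count outside \<open>Y\<close> is eliminated between the two equations; the
    right-hand side depends on \<open>w\<close> only through its valency and its entry of
    \<open>u\<close>.\<close>
  have *: "real (card {y \<in> Y. w \<rightarrow>\<^bsub>G\<^esub> y}) * (a - b) = \<theta> * u $ w - b * real (out_degree G w)" for w
  proof -
    let ?p = "card {y \<in> Y. w \<rightarrow>\<^bsub>G\<^esub> y}" and ?q = "card {y \<in> - Y. w \<rightarrow>\<^bsub>G\<^esub> y}"
    have "out_degree G w = card ({y \<in> Y. w \<rightarrow>\<^bsub>G\<^esub> y} \<union> {y \<in> - Y. w \<rightarrow>\<^bsub>G\<^esub> y})"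
      unfolding out_degree_eq_card[OF G] by (rule arg_cong[of _ _ card]) auto
    also have "\<dots> = ?p + ?q"
      by (intro card_Un_disjoint) auto
    finally have "out_degree G w = ?p + ?q" .
    moreover have "\<theta> * u $ w = (\<Sum>y\<in>UNIV. (if w \<rightarrow>\<^bsub>G\<^esub> y then u $ y else 0))"
    proof -
      have "\<theta> * u $ w = (adj_matrix G *v u) $ w"
        by (simp add: eig)
      also have "\<dots> = (\<Sum>y\<in>UNIV. (if w \<rightarrow>\<^bsub>G\<^esub> y then u $ y else 0))"
        unfolding matrix_vector_mult_def by (auto simp: adj_matrix_def intro!: sum.cong)
      finally show ?thesis .
    qed
    moreover have "\<dots> = (\<Sum>y\<in>UNIV. (if y \<in> Y \<and> w \<rightarrow>\<^bsub>G\<^esub> y then a else 0)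
        + (if y \<in> - Y \<and> w \<rightarrow>\<^bsub>G\<^esub> y then b else 0))"
      using Y by (auto intro!: sum.cong)
    moreover have "\<dots> = real ?p * a + real ?q * b"
      by (simp add: sum.distrib sum.If_cases)
    ultimately show ?thesis
      by (simp add: algebra_simps)
  qed
  have "real (card {y \<in> Y. x \<rightarrow>\<^bsub>G\<^esub> y}) * (a - b) = real (card {y \<in> Y. x' \<rightarrow>\<^bsub>G\<^esub> y}) * (a - b)"
    unfolding * using same by simp
  then show ?thesis
    using \<open>a \<noteq> b\<close> by simp
qed

lemma avg_neighbours_eq_card:
  assumes "finite X" "x \<in> X"
    and "\<And>x'. x' \<in> X \<Longrightarrow> card {y \<in> Y. x' \<rightarrow>\<^bsub>G\<^esub> y} = card {y \<in> Y. x \<rightarrow>\<^bsub>G\<^esub> y}"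
  shows "avg_neighbours G X Y = real (card {y \<in> Y. x \<rightarrow>\<^bsub>G\<^esub> y})"
proof -
  have "(\<Sum>x'\<in>X. real (card {y \<in> Y. x' \<rightarrow>\<^bsub>G\<^esub> y})) = (\<Sum>x'\<in>X. real (card {y \<in> Y. x \<rightarrow>\<^bsub>G\<^esub> y}))"
    using assms(3) by (intro sum.cong) (auto simp only:)
  moreover have "card X \<noteq> 0"
    using assms(1,2) by auto
  ultimately show ?thesis
    by (simp add: avg_neighbours_def)
qed

section \<open>Uniform partitions and common neighbours\<close>

lemma partition_on_card_uniform:
  assumes "finite X" "partition_on X P" "\<And>T. T \<in> P \<Longrightarrow> card T = s"
  shows "card X = card P * s"
proof -
  have "finite T" if "T \<in> P" for T
    using that assms(1,2) by (metis Union_upper finite_subset partition_onD1)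
  then have "card X = (\<Sum>T\<in>P. card T)"
    using assms(2) by (simp add: product_partition)
  then show ?thesis
    using assms(3) by simp
qed

text \<open>The neighbours of a vertex are everything outside its part, so regularity forces equal
  parts. Common neighbours are what lies outside both parts. The equations are additive to avoid
  truncated subtraction.\<close>

lemma multipartite_common_neighbours:
  fixes E :: "'a \<Rightarrow> 'a \<Rightarrow> bool"
  assumes fin: "finite X" and P: "partition_on X P"
    and adj: "\<forall>x\<in>X. \<forall>y\<in>X. E x y \<longleftrightarrow> \<not> (\<exists>T\<in>P. x \<in> T \<and> y \<in> T)"
    and reg: "\<forall>x\<in>X. card {z \<in> X. E x z} = d"
  shows "T \<in> P \<Longrightarrow> card T + d = card X"
    and "S \<in> P \<Longrightarrow> T \<in> P \<Longrightarrow> x \<in> S \<Longrightarrow> y \<in> T \<Longrightarrow>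
      card {z \<in> X. E x z \<and> E z y} + (if S = T then 0 else card T) = d"
proof -
  have sub: "T \<subseteq> X" if "T \<in> P" for T
    using that P by (auto simp: partition_on_def)
  have uniq: "z \<in> T \<longleftrightarrow> S = T" if "S \<in> P" "T \<in> P" "z \<in> S" for S T z
    using that P by (auto simp: partition_on_def disjoint_def)
  have Ex: "E x z \<longleftrightarrow> z \<notin> T" "E z x \<longleftrightarrow> z \<notin> T" if "T \<in> P" "x \<in> T" "z \<in> X" for T x z
    using that sub[OF that(1)] adj uniq by blast+
  have size: "card T + d = card X" if T: "T \<in> P" for T
  proof -
    obtain x where x: "x \<in> T"
      using T P by (metis all_not_in_conv partition_on_def)
    then have "{z \<in> X. E x z} = X - T"
      using Ex T by auto
    moreover have "card {z \<in> X. E x z} = d"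
      using reg x sub[OF T] by blast
    ultimately have "card (X - T) = d"
      by simp
    then show ?thesis
      using card_Diff_subset[of T X] card_mono[OF fin sub[OF T]] finite_subset[OF sub[OF T] fin] sub[OF T]
      by simp
  qed
  show "T \<in> P \<Longrightarrow> card T + d = card X"
    by (rule size)
  assume ST: "S \<in> P" "T \<in> P" "x \<in> S" "y \<in> T"
  have "{z \<in> X. E x z \<and> E z y} = X - (S \<union> T)"
    using Ex(1)[OF ST(1,3)] Ex(2)[OF ST(2,4)] by auto
  moreover have "card (X - (S \<union> T)) + card (S \<union> T) = card X"
    using sub[OF ST(1)] sub[OF ST(2)] fin
    by (metis Un_least card_Diff_subset card_mono finite_subset le_add_diff_inverse2)
  moreover have "card (S \<union> T) = (if S = T then card S else card S + card T)"
  proof (cases "S = T")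
    case False
    then have "S \<inter> T = {}"
      using ST P by (auto simp: partition_on_def disjoint_def)
    moreover have "finite S" "finite T"
      using ST sub fin by (auto intro: finite_subset)
    ultimately show ?thesis
      using False by (simp add: card_Un_disjoint)
  qed simp
  ultimately show "card {z \<in> X. E x z \<and> E z y} + (if S = T then 0 else card T) = d"
    using size[OF ST(1)] by (auto split: if_splits)
qed

text \<open>A neighbour lies in the same clique, so common neighbours exist only within one clique,
  where just \<open>x\<close> and \<open>y\<close> themselves are left out. There the natural
  subtraction of 2 is exact.\<close>

lemma cliques_common_neighbours:
  fixes E :: "'a \<Rightarrow> 'a \<Rightarrow> bool"
  assumes fin: "finite X" and P: "partition_on X P"
    and adj: "\<forall>S\<in>P. \<forall>T\<in>P. \<forall>x\<in>S. \<forall>y\<in>T. E x y \<longleftrightarrow> S = T \<and> x \<noteq> y"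
  shows "T \<in> P \<Longrightarrow> x \<in> T \<Longrightarrow> card {z \<in> X. E x z} + 1 = card T"
    and "S \<in> P \<Longrightarrow> T \<in> P \<Longrightarrow> x \<in> S \<Longrightarrow> y \<in> T \<Longrightarrow> x \<noteq> y \<Longrightarrow>
      card {z \<in> X. E x z \<and> E z y} = (if S = T then card T - 2 else 0)"
proof -
  have X: "z \<in> X \<longleftrightarrow> (\<exists>T\<in>P. z \<in> T)" for z
    using P by (auto simp: partition_on_def)
  have finT: "finite T" if "T \<in> P" for T
    using that X fin by (meson finite_subset subsetI)
  note E = adj[rule_format]
  { assume T: "T \<in> P" "x \<in> T"
    have "{z \<in> X. E x z} = T - {x}"
      using E[OF T(1) _ T(2)] X T by blast
    then show "card {z \<in> X. E x z} + 1 = card T"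
      using T finT by (metis Suc_eq_plus1 card_Suc_Diff1) }
  assume ST: "S \<in> P" "T \<in> P" "x \<in> S" "y \<in> T" "x \<noteq> y"
  have "{z \<in> X. E x z \<and> E z y} = (if S = T then T - {x, y} else {})"
    using E[OF ST(1) _ ST(3)] E[OF _ ST(2) _ ST(4)] X ST by auto
  then show "card {z \<in> X. E x z \<and> E z y} = (if S = T then card T - 2 else 0)"
    using ST card_Diff_subset[of "{x, y}" T] by auto
qed

section \<open>The group divisible design\<close>

text \<open>The \<open>\<theta>0\<close>-eigenvector \<open>\<alpha>\<close> takes two distinct
  values, one on each valency class, and equal valencies give equal entries.\<close>

lemma biregular_equitable:
  assumes T: "three_eigenvalue_graph \<theta>0 \<theta>1 \<theta>2 G" and B: "biregular k1 k2 G"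
    and l: "l \<in> {k1, k2}" and same: "out_degree G x = out_degree G x'"
  shows "card {y \<in> valency_class G l. x \<rightarrow>\<^bsub>G\<^esub> y} = card {y \<in> valency_class G l. x' \<rightarrow>\<^bsub>G\<^esub> y}"
proof -
  let ?\<alpha> = "alpha_vector G \<theta>1 \<theta>2"
  have V: "verts G = UNIV" and G: "graph G"
    using T by (simp_all add: three_eigenvalue_graph_def)
  obtain l' where l': "{l, l'} = {k1, k2}" "l \<noteq> l'"
    using l B by (auto simp: biregular_def)
  have deg: "out_degree G y = l \<or> out_degree G y = l'" for y
    using B V l' by (auto simp: biregular_def)
  \<comment> \<open>Positivity selects the positive root of the known square.\<close>
  have \<alpha>: "?\<alpha> $ y = sqrt (real (out_degree G y) + \<theta>1 * \<theta>2)" for y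
    using three_eigenvalue_graph_alpha_vector(1)[OF T, of y]
    by (simp add: alpha_vector_square[OF T, symmetric])
  show ?thesis
  proof (rule two_valued_eigenvector_equitable[OF G three_eigenvalue_graph_alpha_vector(2)[OF T]])
    show "?\<alpha> $ y = sqrt (real l + \<theta>1 * \<theta>2)" if "y \<in> valency_class G l" for y
      using that by (simp add: \<alpha> valency_class_def)
    show "?\<alpha> $ y = sqrt (real l' + \<theta>1 * \<theta>2)" if "y \<notin> valency_class G l" for y
      using that deg[of y] V by (auto simp: \<alpha> valency_class_def)
  qed (use l' same in \<open>auto simp: \<alpha>\<close>)
qed

text \<open>Induced subgraphs keep adjacency among their own vertices, so the clique structure
  carries over to the relation of \<open>G\<close>, on which the counting is done.\<close>

lemma disjoint_cliques_adjacent: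
  assumes G: "graph G" and V: "V \<subseteq> verts G" and P: "partition_on V P"
    and cl: "\<And>T. T \<in> P \<Longrightarrow> complete_digraph c ((G \<restriction> V) \<restriction> T)"
    and disj: "\<And>S T x y. S \<in> P \<Longrightarrow> T \<in> P \<Longrightarrow> S \<noteq> T \<Longrightarrow> x \<in> S \<Longrightarrow> y \<in> T \<Longrightarrow> \<not> x \<rightarrow>\<^bsub>G \<restriction> V\<^esub> y"
    and xy: "S \<in> P" "T \<in> P" "x \<in> S" "y \<in> T"
  shows "x \<rightarrow>\<^bsub>G\<^esub> y \<longleftrightarrow> S = T \<and> x \<noteq> y"
proof -
  interpret graph G by fact
  interpret H: wf_digraph "G \<restriction> V"
    by (rule wellformed_induce_subgraph)
  have "x \<in> V" "y \<in> V"
    using P xy by (auto simp: partition_on_def)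
  then have eq: "x \<rightarrow>\<^bsub>G \<restriction> V\<^esub> y \<longleftrightarrow> x \<rightarrow>\<^bsub>G\<^esub> y"
    by (rule adjacent_iff_induce_subgraph)
  show ?thesis
  proof (cases "S = T")
    case True
    then have "x \<rightarrow>\<^bsub>(G \<restriction> V) \<restriction> T\<^esub> y \<longleftrightarrow> x \<noteq> y"
      using cl[OF xy(2)] xy by (auto simp: complete_digraph_def)
    then show ?thesis
      using H.adjacent_iff_induce_subgraph[of x T y] xy True eq by blast
  next
    case False
    then show ?thesis
      using disj[OF xy(1,2) _ xy(3,4)] eq by blast
  qed
qed

theorem theorem5p1:
  fixes G :: "('v::finite, 'e) pre_digraph"
    and \<theta>0 \<theta>1 \<theta>2 :: real
    and k n :: "nat \<Rightarrow> nat"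
    and V :: "nat \<Rightarrow> 'v set"
    and kk :: "nat \<Rightarrow> nat \<Rightarrow> real"
    and i j m :: nat
    and \<alpha>i lam1 lam2 :: real
    and w :: 'v
  assumes "three_eigenvalue_graph \<theta>0 \<theta>1 \<theta>2 G"
    and "biregular (k 1) (k 2) G"
    and "\<And>l. V l = valency_class G (k l)"
    and "\<And>l. n l = card (V l)"
    and "\<And>l l'. kk l l' = avg_neighbours G (V l) (V l')"
    and "{i, j} = {1, 2}"
    and "m > 0"
    and "real (n i) / real m \<ge> 2"
    and "w \<in> V i"
    and "\<alpha>i = alpha_vector G \<theta>1 \<theta>2 $ w"
    and "(complete_multipartite m (G \<restriction> V i) \<and>
            lam1 = \<alpha>i\<^sup>2 - kk i i \<and>
            lam2 = \<alpha>i\<^sup>2 + \<theta>1 + \<theta>2 - kk i i + real (n i) / real m)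
       \<or> (disjoint_cliques m (n i div m) (G \<restriction> V i) \<and>
            lam1 = \<alpha>i\<^sup>2 + \<theta>1 + \<theta>2 + 1 - kk i i \<and>
            lam2 = \<alpha>i\<^sup>2)"
  shows "\<exists>B. incidence_matrix (\<lambda>x y. adj_matrix G $ x $ y) (V i) (V j) B \<and>
             group_divisible_design (V i) (V j) B
               (n i) (n j) (kk i j) (kk j i) lam1 lam2 m (n i div m)"
proof -
  note T = assms(1) and V = assms(3) and n = assms(4)
  let ?\<alpha> = "alpha_vector G \<theta>1 \<theta>2"
  have vG: "verts G = UNIV" and G: "graph G"
    using T by (simp_all add: three_eigenvalue_graph_def)
  interpret graph G by fact
  have ij: "i = 1 \<and> j = 2 \<or> i = 2 \<and> j = 1"
    using assms(6) by (auto simp: doubleton_eq_iff)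
  have compl: "V j = - V i"
  proof -
    have "k 1 \<noteq> k 2" "out_degree G x \<in> {k 1, k 2}" for x
      using assms(2) vG by (auto simp: biregular_def)
    then show ?thesis
      using ij vG unfolding V valency_class_def by fastforce
  qed
  have sym: "x \<rightarrow>\<^bsub>G\<^esub> y \<longleftrightarrow> y \<rightarrow>\<^bsub>G\<^esub> x" for x y
    by (rule graph_adjacent_sym[OF G])
  \<comment> \<open>The index \<open>b\<close> is confined to \<open>{i, j}\<close> because only
    \<open>k 1\<close> and \<open>k 2\<close> are known to be valencies of \<open>G\<close>.\<close>
  have equitable: "real (card {y \<in> V b. x \<rightarrow>\<^bsub>G\<^esub> y}) = kk a b"
    if "x \<in> V a" "b \<in> {i, j}" for a b x
  proof -
    have "k b \<in> {k 1, k 2}"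
      using that(2) ij by auto
    then have eq: "card {y \<in> V b. x' \<rightarrow>\<^bsub>G\<^esub> y} = card {y \<in> V b. x \<rightarrow>\<^bsub>G\<^esub> y}" if "x' \<in> V a" for x'
    proof -
      have "out_degree G x' = out_degree G x"
        using that \<open>x \<in> V a\<close> by (simp add: V valency_class_def)
      then show ?thesis
        unfolding V by (rule biregular_equitable[OF T assms(2) \<open>k b \<in> {k 1, k 2}\<close>])
    qed
    show ?thesis
      unfolding assms(5) by (rule avg_neighbours_eq_card[OF finite that(1) eq, symmetric])
  qed
  define d where "d = card {y \<in> V i. w \<rightarrow>\<^bsub>G\<^esub> y}"
  have d: "kk i i = real d"
    using equitable[of w i i] assms(9) by (simp add: d_def)
  have reg: "\<forall>x\<in>V i. card {y \<in> V i. x \<rightarrow>\<^bsub>G\<^esub> y} = d"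
    using equitable[of _ i i] d by simp
  have \<alpha>: "?\<alpha> $ x = \<alpha>i" if "x \<in> V i" for x
  proof -
    have "(?\<alpha> $ x)\<^sup>2 = \<alpha>i\<^sup>2"
      using that assms(9) unfolding assms(10) alpha_vector_square[OF T] V valency_class_def by simp
    then show ?thesis
      using three_eigenvalue_graph_alpha_vector(1)[OF T] unfolding assms(10)
      by (metis less_imp_le power2_eq_imp_eq)
  qed
  \<comment> \<open>The common neighbours of \<open>x\<close> and \<open>y\<close> number
    \<open>\<alpha>i\<^sup>2\<close>, plus \<open>\<theta>1 + \<theta>2\<close> if they are
    adjacent; removing those in \<open>V i\<close> leaves the ones in \<open>V j\<close>, which are
    the blocks through both points.\<close>
  have common: "real (card {z \<in> V j. z \<rightarrow>\<^bsub>G\<^esub> x \<and> z \<rightarrow>\<^bsub>G\<^esub> y}) =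
      \<alpha>i\<^sup>2 + (if x \<rightarrow>\<^bsub>G\<^esub> y then \<theta>1 + \<theta>2 else 0) - real (card {z \<in> V i. x \<rightarrow>\<^bsub>G\<^esub> z \<and> z \<rightarrow>\<^bsub>G\<^esub> y})"
    if "x \<in> V i" "y \<in> V i" "x \<noteq> y" for x y
  proof -
    let ?C = "\<lambda>X. {z \<in> X. x \<rightarrow>\<^bsub>G\<^esub> z \<and> z \<rightarrow>\<^bsub>G\<^esub> y}"
    have "?C UNIV = ?C (V i) \<union> ?C (V j)"
      using compl by blast
    then have "card (?C UNIV) = card (?C (V i)) + card (?C (V j))"
      using compl by (simp add: card_Un_disjoint disjoint_iff)
    moreover have "?C (V j) = {z \<in> V j. z \<rightarrow>\<^bsub>G\<^esub> x \<and> z \<rightarrow>\<^bsub>G\<^esub> y}"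
      using sym by blast
    ultimately show ?thesis
      using alpha_vector_common_neighbours[OF T, of x y] that
      by (simp add: \<alpha> adj_matrix_def power2_eq_square split: if_splits)
  qed
  \<comment> \<open>Both cases are reduced to one claim: the count from \<open>common\<close>
    depends only on whether the two points share a part.\<close>
  have parts: "\<exists>P. partition_on (V i) P \<and> card P = m \<and> (\<forall>S\<in>P. card S = n i div m) \<and>
      (\<forall>S\<in>P. \<forall>T\<in>P. \<forall>x\<in>S. \<forall>y\<in>T. x \<noteq> y \<longrightarrow>
        \<alpha>i\<^sup>2 + (if x \<rightarrow>\<^bsub>G\<^esub> y then \<theta>1 + \<theta>2 else 0) - real (card {z \<in> V i. x \<rightarrow>\<^bsub>G\<^esub> z \<and> z \<rightarrow>\<^bsub>G\<^esub> y})
          = (if S = T then lam1 else lam2))"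
    using assms(11)
  proof (elim disjE conjE)
    assume "complete_multipartite m (G \<restriction> V i)"
      and lam: "lam1 = \<alpha>i\<^sup>2 - kk i i" "lam2 = \<alpha>i\<^sup>2 + \<theta>1 + \<theta>2 - kk i i + real (n i) / real m"
    then obtain P where P: "partition_on (V i) P" "card P = m"
      and "\<forall>x\<in>V i. \<forall>y\<in>V i. x \<rightarrow>\<^bsub>G \<restriction> V i\<^esub> y \<longleftrightarrow> \<not> (\<exists>S\<in>P. x \<in> S \<and> y \<in> S)"
      unfolding complete_multipartite_def by auto
    then have E: "x \<rightarrow>\<^bsub>G\<^esub> y \<longleftrightarrow> \<not> (\<exists>S\<in>P. x \<in> S \<and> y \<in> S)" if "x \<in> V i" "y \<in> V i" for x y
      using adjacent_iff_induce_subgraph[OF that] that by simp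
    have "\<forall>x\<in>V i. \<forall>y\<in>V i. x \<rightarrow>\<^bsub>G\<^esub> y \<longleftrightarrow> \<not> (\<exists>S\<in>P. x \<in> S \<and> y \<in> S)"
      using E by blast
    note mp = multipartite_common_neighbours[OF finite P(1) this reg]
    \<comment> \<open>Each part has this size, as it consists of the vertices of \<open>V i\<close>
      not adjacent to a given member. Hence \<open>n i = m * s\<close>, and natural and real
      division agree.\<close>
    define s where "s = n i - d"
    have card_s: "card S = s" if "S \<in> P" for S
      using mp(1)[OF that] n[of i] by (simp add: s_def)
    have "n i = m * s"
      using partition_on_card_uniform[OF finite P(1) card_s] P(2) n[of i] by simp
    then have s: "n i div m = s" "real (n i) / real m = real s"
      using assms(7) by simp_all
    have "\<alpha>i\<^sup>2 + (if x \<rightarrow>\<^bsub>G\<^esub> y then \<theta>1 + \<theta>2 else 0) - real (card {z \<in> V i. x \<rightarrow>\<^bsub>G\<^esub> z \<and> z \<rightarrow>\<^bsub>G\<^esub> y})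
          = (if S = T then lam1 else lam2)" if "S \<in> P" "T \<in> P" "x \<in> S" "y \<in> T" for S T x y
    proof -
      have "x \<in> V i" "y \<in> V i"
        using P(1) that by (auto simp: partition_on_def)
      moreover have "(\<exists>S\<in>P. x \<in> S \<and> y \<in> S) \<longleftrightarrow> S = T"
        using partition_onD2[OF P(1)] that unfolding disjoint_def by blast
      ultimately have "x \<rightarrow>\<^bsub>G\<^esub> y \<longleftrightarrow> S \<noteq> T"
        using E by blast
      \<comment> \<open>Within a part the points are nonadjacent with \<open>d\<close> common
        neighbours in \<open>V i\<close>; across parts they are adjacent with
        \<open>d - s\<close>.\<close>
      then show ?thesis
        using mp(2)[OF that] card_s[OF that(2)] d s(2)
        by (cases "S = T") (simp_all add: lam)
    qed
    then show ?thesis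
      using P card_s s(1) by blast
  next
    assume "disjoint_cliques m (n i div m) (G \<restriction> V i)"
      and lam: "lam1 = \<alpha>i\<^sup>2 + \<theta>1 + \<theta>2 + 1 - kk i i" "lam2 = \<alpha>i\<^sup>2"
    then obtain P where P: "partition_on (V i) P" "card P = m"
      and cl: "\<forall>T\<in>P. complete_digraph (n i div m) ((G \<restriction> V i) \<restriction> T)"
      and disj: "\<forall>S\<in>P. \<forall>T\<in>P. S \<noteq> T \<longrightarrow> (\<forall>x\<in>S. \<forall>y\<in>T. \<not> x \<rightarrow>\<^bsub>G \<restriction> V i\<^esub> y)"
      unfolding disjoint_cliques_def by auto
    have E: "x \<rightarrow>\<^bsub>G\<^esub> y \<longleftrightarrow> S = T \<and> x \<noteq> y" if "S \<in> P" "T \<in> P" "x \<in> S" "y \<in> T" for S T x y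
      by (rule disjoint_cliques_adjacent[OF G _ P(1) _ _ that]) (use vG cl disj in auto)
    have size: "card S = n i div m" if "S \<in> P" for S
      using cl that by (auto simp: complete_digraph_def)
    have "\<forall>S\<in>P. \<forall>T\<in>P. \<forall>x\<in>S. \<forall>y\<in>T. x \<rightarrow>\<^bsub>G\<^esub> y \<longleftrightarrow> S = T \<and> x \<noteq> y"
      using E by blast
    note cn = cliques_common_neighbours[OF finite P(1) this]
    have "\<alpha>i\<^sup>2 + (if x \<rightarrow>\<^bsub>G\<^esub> y then \<theta>1 + \<theta>2 else 0) - real (card {z \<in> V i. x \<rightarrow>\<^bsub>G\<^esub> z \<and> z \<rightarrow>\<^bsub>G\<^esub> y})
          = (if S = T then lam1 else lam2)" if "S \<in> P" "T \<in> P" "x \<in> S" "y \<in> T" "x \<noteq> y" for S T x y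
    proof -
      have "x \<in> V i"
        using P(1) that by (auto simp: partition_on_def)
      then have "d + 1 = card S"
        using cn(1)[OF that(1,3)] reg by simp
      \<comment> \<open>Two points of a clique of size \<open>d + 1\<close> have
        \<open>d - 1\<close> common neighbours in it; the neighbour \<open>y\<close> of
        \<open>x\<close> makes this subtraction exact. Across cliques there is neither adjacency nor
        a common neighbour in \<open>V i\<close>.\<close>
      moreover have "d \<ge> 1" if "S = T"
      proof -
        have "y \<in> {z \<in> V i. x \<rightarrow>\<^bsub>G\<^esub> z}"
          using E \<open>S \<in> P\<close> \<open>x \<in> S\<close> \<open>y \<in> T\<close> \<open>x \<noteq> y\<close> that P(1) by (auto simp: partition_on_def)
        then show ?thesis
          using reg \<open>x \<in> V i\<close> by (metis One_nat_def Suc_leI card_gt_0_iff empty_iff finite)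
      qed
      ultimately show ?thesis
        using cn(2)[OF that] E[OF that(1-4)] that(5) d
        by (cases "S = T") (simp_all add: lam of_nat_diff)
    qed
    then show ?thesis
      using P size by blast
  qed
  then obtain P where P: "partition_on (V i) P" "card P = m" "\<forall>S\<in>P. card S = n i div m"
    and lam: "\<forall>S\<in>P. \<forall>T\<in>P. \<forall>x\<in>S. \<forall>y\<in>T. x \<noteq> y \<longrightarrow>
        \<alpha>i\<^sup>2 + (if x \<rightarrow>\<^bsub>G\<^esub> y then \<theta>1 + \<theta>2 else 0) - real (card {z \<in> V i. x \<rightarrow>\<^bsub>G\<^esub> z \<and> z \<rightarrow>\<^bsub>G\<^esub> y})
          = (if S = T then lam1 else lam2)"
    by (elim exE conjE) (rule that)
  \<comment> \<open>A block is the neighbourhood in \<open>V i\<close> of a vertex of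
    \<open>V j\<close>; equitability then gives both the block size and the replication
    number.\<close>
  define B where "B z = {x \<in> V i. z \<rightarrow>\<^bsub>G\<^esub> x}" for z
  have "incidence_matrix (\<lambda>x y. adj_matrix G $ x $ y) (V i) (V j) B"
    by (auto simp: incidence_matrix_def adj_matrix_def B_def sym)
  moreover have "configuration (V i) (V j) B (n i) (n j) (kk i j) (kk j i)"
  proof -
    have "{z \<in> V j. x \<in> B z} = {z \<in> V j. x \<rightarrow>\<^bsub>G\<^esub> z}" if "x \<in> V i" for x
      using that by (auto simp: B_def sym)
    then show ?thesis
      using equitable[of _ i j] equitable[of _ j i] by (auto simp: configuration_def n B_def)
  qed
  moreover have "n i div m \<ge> 2"
  proof -
    have "2 * m \<le> n i"
      using assms(7,8) by (simp add: field_simps)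
    then show ?thesis
      using assms(7) by (simp add: less_eq_div_iff_mult_less_eq)
  qed
  moreover have "real (card {z \<in> V j. x \<in> B z \<and> y \<in> B z}) = (if S = T then lam1 else lam2)"
    if "S \<in> P" "T \<in> P" "x \<in> S" "y \<in> T" "x \<noteq> y" for S T x y
  proof -
    have xy: "x \<in> V i" "y \<in> V i"
      using P(1) that by (auto simp: partition_on_def)
    then have "{z \<in> V j. x \<in> B z \<and> y \<in> B z} = {z \<in> V j. z \<rightarrow>\<^bsub>G\<^esub> x \<and> z \<rightarrow>\<^bsub>G\<^esub> y}"
      by (auto simp: B_def)
    then show ?thesis
      using common[OF xy that(5)] lam that by simp
  qed
  ultimately show ?thesis
    unfolding group_divisible_design_def using P by blast
qed

end
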